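(* Let $C \in M_n$ and let $\mathcal{G}$ be a non-empty (finite or infinite) family of matrices in $M_n$. If $\mu \in \bigcap_{A\in\mathcal{G}} S_C(A)$, then for $\mathcal{F} = \mathrm{conv}\,\mathcal{G}$ the set $W_C(\mathcal{F})$ is star-shaped with star-center $\mu$.
   Context: $M_n$ is the set of $n\times n$ complex matrices. For $C, A \in M_n$, $W_C(A) = \{\mathrm{tr}(CU^*AU) : U \in M_n \text{ unitary}\} \subseteq \mathbb{C}$. For a non-empty $\mathcal{F}\subseteq M_n$, $W_C(\mathcal{F}) = \bigcup\{W_C(A) : A \in \mathcal{F}\}$. A set $S\subseteq\mathbb{C}$ is star-shaped with star-center $\mu\in S$ if $t\nu+(1-t)\mu\in S$ for all $\nu\in S$ and $t\in[0,1]$. $S_C(A)$ denotes the set of all star-centers of $W_C(A)$. $\mathrm{conv}$ denotes convex hull. *)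

theory Defs
  imports "HOL-Analysis.Analysis"
begin

definition conj_transpose :: "complex^'n^'m \<Rightarrow> complex^'m^'n" where
  "conj_transpose A = (\<chi> i j. cnj (A $ j $ i))"

definition unitary :: "complex^'n^'n \<Rightarrow> bool" where
  "unitary U \<longleftrightarrow> conj_transpose U ** U = mat 1 \<and> U ** conj_transpose U = mat 1"

definition C_numerical_range :: "complex^'n^'n \<Rightarrow> complex^'n^'n \<Rightarrow> complex set" where
  "C_numerical_range C A = {trace (C ** conj_transpose U ** A ** U) | U. unitary U}"

definition C_numerical_range_family ::
    "complex^'n^'n \<Rightarrow> (complex^'n^'n) set \<Rightarrow> complex set" where
  "C_numerical_range_family C F = (\<Union>A\<in>F. C_numerical_range C A)"

definition is_star_center :: "complex set \<Rightarrow> complex \<Rightarrow> bool" where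
  "is_star_center S \<mu> \<longleftrightarrow>
     \<mu> \<in> S \<and> (\<forall>\<nu>\<in>S. \<forall>t::real. 0 \<le> t \<and> t \<le> 1 \<longrightarrow>
        complex_of_real t * \<nu> + complex_of_real (1 - t) * \<mu> \<in> S)"

definition star_centers :: "complex^'n^'n \<Rightarrow> complex^'n^'n \<Rightarrow> complex set" where
  "star_centers C A = {\<mu>. is_star_center (C_numerical_range C A) \<mu>}"

end

theory Submission
  imports Defs
begin

text \<open>
  Suppose that a point \<open>p\<close> of the segment from \<open>\<mu>\<close> to \<open>\<nu> \<in> W\<^sub>C(\<F>)\<close> is not in \<open>W\<^sub>C(\<F>)\<close>, and write
  \<open>f V A = tr (C V\<^sup>* A V)\<close>. For \<open>A \<in> \<G>\<close> the set \<open>W\<^sub>C(A)\<close> is star-shaped about \<open>\<mu>\<close> and misses \<open>p\<close>, so seen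
  from \<open>p\<close> no point of it lies in the direction opposite to \<open>\<mu>\<close>. Hence the angle
  \<open>\<theta>\<^sub>A V = Arg ((f V A - p) / (\<mu> - p))\<close> is in the open interval from \<open>-\<pi>\<close> to \<open>\<pi>\<close> and continuous in
  \<open>V\<close>. For \<open>A, B \<in> \<G>\<close> the difference \<open>\<bar>\<theta>\<^sub>A V - \<theta>\<^sub>B V\<bar>\<close> is never \<open>\<pi>\<close>, as \<open>p\<close> would then be on the segment
  from \<open>f V A\<close> to \<open>f V B\<close>, and it is less than \<open>\<pi>\<close> where \<open>f V A = \<mu>\<close>. The unitary group being
  connected, it is always less than \<open>\<pi>\<close>. For \<open>\<nu> = f U (\<Sum>\<^sub>B w\<^sub>B B)\<close>, the points \<open>\<mu>\<close> and \<open>f U B\<close> therefore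
  all lie in one open half plane bounded by a line through \<open>p\<close>, although \<open>p\<close> is in their convex hull.
\<close>

section \<open>Rank-one updates of the identity and connectedness of the unitary group\<close>

definition rank_one_update :: "complex \<Rightarrow> complex^'n \<Rightarrow> complex^'n^'n" where
  "rank_one_update c v = (\<chi> i j. (if i = j then 1 else 0) - c * v $ i * cnj (v $ j))"

lemma sum_mult_cnj_self:
  fixes v :: "complex^'n"
  shows "(\<Sum>k\<in>UNIV. cnj (v $ k) * v $ k) = complex_of_real ((norm v)\<^sup>2)"
  by (simp add: norm_vec_def L2_set_def sum_nonneg complex_norm_square mult.commute del: of_real_power)

lemma rank_one_update_mult:
  fixes v :: "complex^'n"
  shows "rank_one_update a v ** rank_one_update b v =
    rank_one_update (a + b - a * b * complex_of_real ((norm v)\<^sup>2)) v"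
proof -
  have "(\<Sum>k\<in>UNIV. ((if i = k then 1 else 0) - a * v $ i * cnj (v $ k)) *
          ((if k = j then 1 else 0) - b * v $ k * cnj (v $ j))) =
        (if i = j then 1 else 0) - (a + b - a * b * complex_of_real ((norm v)\<^sup>2)) * v $ i * cnj (v $ j)"
    (is "?l = ?r") for i j :: 'n
  proof -
    have "?l = (\<Sum>k\<in>UNIV. (if i = k then if k = j then 1 else 0 else 0)
        - (if i = k then b * v $ k * cnj (v $ j) else 0)
        - (if k = j then a * v $ i * cnj (v $ k) else 0)
        + a * b * v $ i * cnj (v $ j) * (cnj (v $ k) * v $ k))"
      by (intro sum.cong) (auto simp: algebra_simps)
    also have "\<dots> = (if i = j then 1 else 0) - b * v $ i * cnj (v $ j) - a * v $ i * cnj (v $ j)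
        + a * b * v $ i * cnj (v $ j) * complex_of_real ((norm v)\<^sup>2)"
      unfolding sum_mult_cnj_self[symmetric]
      by (simp add: sum.distrib sum_subtractf sum_distrib_left)
    finally show ?thesis
      by (simp add: algebra_simps)
  qed
  then show ?thesis
    by (simp add: rank_one_update_def matrix_matrix_mult_def)
qed

lemma conj_transpose_rank_one_update:
  "conj_transpose (rank_one_update c v) = rank_one_update (cnj c) v"
  by (auto simp: rank_one_update_def conj_transpose_def vec_eq_iff)

lemma rank_one_update_0 [simp]: "rank_one_update 0 v = mat 1"
  by (simp add: rank_one_update_def mat_def)

text \<open>The adjoint has coefficient \<open>cnj c\<close>; in its product with the update, in
  either order, the hypothesis makes the resulting coefficient 0.\<close>

lemma unitary_rank_one_update:
  assumes "c + cnj c = c * cnj c * complex_of_real ((norm v)\<^sup>2)"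
  shows "unitary (rank_one_update c v)"
  using assms
  by (simp add: unitary_def conj_transpose_rank_one_update rank_one_update_mult algebra_simps)

lemma conj_transpose_mult:
  "conj_transpose (A ** B) = conj_transpose B ** conj_transpose A"
  by (simp add: conj_transpose_def matrix_matrix_mult_def vec_eq_iff mult.commute)

lemma unitary_mult:
  assumes "unitary U" "unitary V"
  shows "unitary (U ** V)"
proof -
  have "conj_transpose (U ** V) ** (U ** V) = conj_transpose V ** (conj_transpose U ** U) ** V"
    by (simp add: conj_transpose_mult matrix_mul_assoc)
  moreover have "(U ** V) ** conj_transpose (U ** V) = U ** (V ** conj_transpose V) ** conj_transpose U"
    by (simp add: conj_transpose_mult matrix_mul_assoc)
  ultimately show ?thesis
    using assms by (simp add: unitary_def)
qed

lemma unitary_mat_1: "unitary (mat 1)"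
proof -
  have "conj_transpose (mat 1 :: complex^'n^'n) = mat 1"
    by (auto simp: conj_transpose_def mat_def vec_eq_iff)
  then show ?thesis
    by (simp add: unitary_def)
qed

text \<open>
  The update is unitary exactly when \<open>1 - c \<parallel>v\<parallel>\<^sup>2\<close>, its eigenvalue at \<open>v\<close>, has modulus 1; the path
  moves this eigenvalue along the unit circle.
\<close>
lemma connected_component_unitary_rank_one_update:
  fixes U :: "complex^'n^'n"
  assumes U: "unitary U" and c: "c + cnj c = c * cnj c * complex_of_real ((norm v)\<^sup>2)"
  shows "connected_component (Collect unitary) U (rank_one_update c v ** U)"
proof (cases "v = 0")
  case True
  then have "rank_one_update c v = mat 1"
    by (simp add: rank_one_update_def mat_def)
  then show ?thesis
    using U by simp
next
  case False
  define s where "s = complex_of_real ((norm v)\<^sup>2)"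
  define g where "g z = rank_one_update ((1 - z) / s) v ** U" for z
  have s: "s \<noteq> 0" "cnj s = s"
    using False by (auto simp: s_def)
  have "connected (g ` sphere 0 1)"
    by (intro connected_continuous_image connected_sphere)
      (auto simp: g_def rank_one_update_def matrix_matrix_mult_def s
        intro!: continuous_intros)
  moreover have "g ` sphere 0 1 \<subseteq> Collect unitary"
  proof clarsimp
    fix z :: complex
    assume "cmod z = 1"
    then have "z * cnj z = 1"
      by (simp flip: complex_norm_square)
    then have "(1 - z) / s + cnj ((1 - z) / s) = (1 - z) / s * cnj ((1 - z) / s) * s"
      using s by (simp add: field_simps)
    then show "unitary (g z)"
      unfolding g_def s_def using U by (intro unitary_mult unitary_rank_one_update)
  qed
  moreover have "U \<in> g ` sphere 0 1"
    by (rule image_eqI[of _ _ 1]) (simp_all add: g_def)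
  moreover have "rank_one_update c v ** U \<in> g ` sphere 0 1"
  proof (rule image_eqI[of _ _ "1 - c * s"])
    have "(1 - c * s) * cnj (1 - c * s) = 1 - s * (c + cnj c - c * cnj c * s)"
      using s by (simp add: algebra_simps)
    also have "\<dots> = 1"
      using c by (simp add: s_def)
    finally have "complex_of_real ((cmod (1 - c * s))\<^sup>2) = 1"
      by (simp add: complex_norm_square del: of_real_power)
    then have "(cmod (1 - c * s))\<^sup>2 = 1"
      using of_real_eq_1_iff by blast
    then show "1 - c * s \<in> sphere 0 1"
      by (simp add: power2_eq_1_iff del: of_real_power) (smt (verit) norm_ge_zero)
  qed (use s in \<open>simp add: g_def\<close>)
  ultimately show ?thesis
    by (meson connected_component_def)
qed

text \<open>Householder-style reduction: \<open>S\<close> holds the indices of the columns that may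
  still differ from the standard basis. Each induction step removes one index, multiplying by a
  reflection if that column is not yet standard, without leaving the connected component.\<close>

lemma connected_component_unitary_mat_1:
  fixes U :: "complex^'n^'n"
  assumes "finite S" "unitary U" "\<And>i. i \<notin> S \<Longrightarrow> column i U = axis i 1"
  shows "connected_component (Collect unitary) (mat 1) U"
  using assms
proof (induction S arbitrary: U)
  case empty
  then have "U = mat 1"
    by (simp add: vec_eq_iff column_def axis_def mat_def)
  then show ?case
    by (simp add: unitary_mat_1)
next
  case (insert j S)
  txt \<open>
    The update \<open>R\<close> below is the complex reflection along \<open>U e\<^sub>j - e\<^sub>j\<close> that maps \<open>U e\<^sub>j\<close> to \<open>e\<^sub>j\<close>. It fixes the
    other basis vectors fixed by \<open>U\<close>, as they are orthogonal to \<open>v\<close>.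
  \<close>
  define v where "v = column j U - axis j 1"
  define w where "w = 1 - U $ j $ j"
  have orth: "(\<Sum>k\<in>UNIV. cnj (U $ k $ a) * U $ k $ b) = (if a = b then 1 else 0)" for a b
    using insert.prems(1)
    by (simp add: unitary_def conj_transpose_def matrix_matrix_mult_def mat_def vec_eq_iff)
  have col: "U $ k $ i = (if k = i then 1 else 0)" if "i \<notin> insert j S" for i k
    using insert.prems(2)[OF that] by (simp add: column_def axis_def vec_eq_iff)
  have row: "U $ i $ b = (if i = b then 1 else 0)" if "i \<notin> insert j S" for i b
    using orth[of i b] by (simp add: col[OF that] if_distrib if_distribR cong: if_cong)
  have v: "v $ k = U $ k $ j - (if k = j then 1 else 0)" for k
    by (simp add: v_def column_def axis_def)
  \<comment> \<open>Expand \<open>v\<close> as column \<open>j\<close> of \<open>U\<close> minus a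
    basis vector: by orthonormality the first part contributes row \<open>j\<close> of the identity,
    the second row \<open>j\<close> of \<open>U\<close>.\<close>
  have vU: "(\<Sum>k\<in>UNIV. cnj (v $ k) * U $ k $ b) = (if b = j then 1 else 0) - U $ j $ b" for b
  proof -
    have "(\<Sum>k\<in>UNIV. cnj (v $ k) * U $ k $ b) =
      (\<Sum>k\<in>UNIV. cnj (U $ k $ j) * U $ k $ b) - (\<Sum>k\<in>UNIV. if k = j then U $ k $ b else 0)"
      unfolding sum_subtractf[symmetric] by (intro sum.cong) (auto simp: v algebra_simps)
    then show ?thesis
      by (simp add: orth eq_commute)
  qed
  have "(\<Sum>k\<in>UNIV. cnj (v $ k) * v $ k) = w + cnj w"
  proof -
    have "(\<Sum>k\<in>UNIV. cnj (v $ k) * v $ k) =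
      (\<Sum>k\<in>UNIV. cnj (v $ k) * U $ k $ j) - (\<Sum>k\<in>UNIV. if k = j then cnj (v $ k) else 0)"
      unfolding sum_subtractf[symmetric] by (intro sum.cong) (auto simp: v algebra_simps)
    also have "\<dots> = 1 - U $ j $ j - cnj (v $ j)"
      by (simp add: vU)
    finally show ?thesis
      by (simp add: w_def v)
  qed
  then have norm_v: "complex_of_real ((norm v)\<^sup>2) = w + cnj w"
    by (simp add: sum_mult_cnj_self)
  show ?case
  proof (cases "w = 0")
    case True
    then have "v = 0"
      using norm_v by simp
    then have "column j U = axis j 1"
      by (simp add: v_def)
    then show ?thesis
      using insert by (metis insertE)
  next
    case False
    \<comment> \<open>By \<open>vU\<close> the inner product of \<open>v\<close> with column
      \<open>j\<close> of \<open>U\<close> is \<open>w\<close>, so the coefficient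
      \<open>inverse w\<close> subtracts exactly \<open>v\<close> from that column.\<close>
    define R where "R = rank_one_update (inverse w) v"
    have c: "inverse w + cnj (inverse w) = inverse w * cnj (inverse w) * complex_of_real ((norm v)\<^sup>2)"
    proof -
      have "inverse w * inverse w' * (w + w') = inverse w + inverse w'" if "w' \<noteq> 0" for w'
        using False that by (simp add: field_simps)
      from this[of "cnj w"] show ?thesis
        unfolding norm_v using False by simp
    qed
    have "(R ** U) $ a $ b = U $ a $ b - inverse w * v $ a * ((if b = j then 1 else 0) - U $ j $ b)"
      for a b
    proof -
      have "(R ** U) $ a $ b =
        (\<Sum>k\<in>UNIV. (if a = k then U $ k $ b else 0) - inverse w * v $ a * (cnj (v $ k) * U $ k $ b))"
        by (auto simp: R_def rank_one_update_def matrix_matrix_mult_def algebra_simps intro!: sum.cong)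
      then show ?thesis
        by (simp add: sum_subtractf flip: vU sum_distrib_left)
    qed
    note RU = this
    have Ujj: "U $ j $ j = 1 - w"
      by (simp add: w_def)
    have "column i (R ** U) = axis i 1" if "i \<notin> S" for i
    proof (cases "i = j")
      case True
      then show ?thesis
        using False by (simp add: vec_eq_iff column_def axis_def RU v Ujj algebra_simps)
    next
      case i: False
      then have "i \<notin> insert j S"
        using that by simp
      then show ?thesis
        using i by (simp add: vec_eq_iff column_def axis_def RU col)
    qed
    then have "connected_component (Collect unitary) (mat 1) (R ** U)"
      using insert.prems(1) c unfolding R_def
      by (intro insert.IH unitary_mult unitary_rank_one_update)
    moreover have "connected_component (Collect unitary) U (R ** U)"
      unfolding R_def using insert.prems(1) c by (rule connected_component_unitary_rank_one_update)
    ultimately show ?thesis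
      by (meson connected_component_sym connected_component_trans)
  qed
qed

lemma connected_unitary: "connected {U :: complex^'n^'n. unitary U}"
proof -
  have "connected_component (Collect unitary) (mat 1) U" if "unitary U" for U :: "complex^'n^'n"
    using connected_component_unitary_mat_1[of UNIV U] that by simp
  then show ?thesis
    unfolding connected_iff_connected_component
    by (metis connected_component_sym connected_component_trans mem_Collect_eq)
qed

section \<open>Linearity and continuity of the trace expression\<close>

lemma linear_trace_conjugate:
  "linear (\<lambda>A. trace (C ** conj_transpose U ** A ** U))"
  by (rule linearI)
    (simp_all add: trace_def matrix_matrix_mult_def sum.distrib algebra_simps scaleR_sum_right
      sum_distrib_left sum_distrib_right)

lemma continuous_on_trace_conjugate:
  "continuous_on S (\<lambda>U. trace (C ** conj_transpose U ** A ** U))"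
  by (auto simp: trace_def matrix_matrix_mult_def conj_transpose_def intro!: continuous_intros)

section \<open>Arguments, half planes and segments in the complex plane\<close>

lemma Arg_diff_eq_pi_imp_segment:
  assumes "x \<noteq> 0" "y \<noteq> 0" "\<bar>Arg x - Arg y\<bar> = pi"
  shows "0 \<in> closed_segment x y"
proof -
  have "cis (Arg y) = - cis (Arg x)"
  proof (cases "Arg y = Arg x + pi")
    case False
    then have "Arg x = Arg y + pi"
      using assms(3) by linarith
    then show ?thesis
      by (simp add: flip: cis_mult)
  qed (simp flip: cis_mult)
  moreover have "x = cmod x * cis (Arg x)" "y = cmod y * cis (Arg y)"
    using rcis_cmod_Arg[of x] rcis_cmod_Arg[of y] by (simp_all add: rcis_def)
  \<comment> \<open>Weighting each of two opposite vectors by the modulus of the other gives them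
    equal length, so they cancel.\<close>
  ultimately have "cmod y *\<^sub>R x + cmod x *\<^sub>R y = 0"
    by (simp add: scaleR_conv_of_real) (metis add.right_inverse mult.left_commute mult_minus_right)
  moreover have "cmod x + cmod y > 0"
    using assms by (simp add: add_pos_pos)
  moreover have "inverse (cmod x + cmod y) *\<^sub>R (cmod y *\<^sub>R x + cmod x *\<^sub>R y) =
      (1 - cmod x / (cmod x + cmod y)) *\<^sub>R x + (cmod x / (cmod x + cmod y)) *\<^sub>R y"
    if "cmod x + cmod y > 0"
    using that by (simp add: scaleR_add_right field_simps del: scaleR_right.add)
  ultimately have "0 = (1 - cmod x / (cmod x + cmod y)) *\<^sub>R x + (cmod x / (cmod x + cmod y)) *\<^sub>R y"
    by (metis scaleR_zero_right)
  moreover have "cmod x / (cmod x + cmod y) \<le> 1"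
    using \<open>cmod x + cmod y > 0\<close> by simp
  ultimately show ?thesis
    unfolding in_segment by (metis divide_nonneg_nonneg norm_ge_zero add_nonneg_nonneg)
qed

text \<open>The direction midway between the extreme arguments makes an angle below \<pi>/2 with
  every point of \<open>X\<close>, so it is the inner normal of an open half plane that contains
  \<open>X\<close> and has 0 on its boundary.\<close>

lemma zero_notin_convex_hull_if_Arg_close:
  assumes "finite X" "0 \<notin> X" "\<And>x y. x \<in> X \<Longrightarrow> y \<in> X \<Longrightarrow> \<bar>Arg x - Arg y\<bar> < pi"
  shows "0 \<notin> convex hull X"
proof (cases "X = {}")
  case False
  define T where "T = Arg ` X"
  define m where "m = (Max T + Min T) / 2"
  have T: "finite T" "T \<noteq> {}"
    using assms(1) False by (auto simp: T_def)
  obtain y z where "y \<in> X" "z \<in> X" "Max T = Arg y" "Min T = Arg z"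
    using Max_in[OF T] Min_in[OF T] by (auto simp: T_def)
  then have "Max T - Min T < pi"
    using assms(3)[of y z] by simp
  have "X \<subseteq> {x. cis m \<bullet> x > 0}"
  proof
    fix x
    assume "x \<in> X"
    then have "Arg x \<le> Max T" "Min T \<le> Arg x" and "x \<noteq> 0"
      using T assms(2) by (auto simp: T_def)
    moreover have "2 * m = Max T + Min T"
      by (simp add: m_def)
    ultimately have "cos (m - Arg x) > 0"
      using \<open>Max T - Min T < pi\<close> by (intro cos_gt_zero_pi) linarith+
    moreover have "cis m \<bullet> x = cmod x * cos (m - Arg x)"
      by (subst rcis_cmod_Arg[of x, symmetric])
        (simp add: rcis_def inner_complex_def cos_diff algebra_simps)
    ultimately show "x \<in> {x. cis m \<bullet> x > 0}"
      using \<open>x \<noteq> 0\<close> by simp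
  qed
  then have "convex hull X \<subseteq> {x. cis m \<bullet> x > 0}"
    by (simp add: hull_minimal convex_halfspace_gt)
  then show ?thesis
    by auto
qed simp

text \<open>If the quotient were a real r \<le> 0, solving for \<open>p\<close> would give p =
  (\<nu> - r \<mu>) / (1 - r), a point of the segment from \<mu> to \<nu>.\<close>

lemma star_center_imp_notin_nonpos_Reals:
  assumes "is_star_center S \<mu>" "p \<notin> S" "\<nu> \<in> S"
  shows "(\<nu> - p) / (\<mu> - p) \<notin> \<real>\<^sub>\<le>\<^sub>0"
proof
  assume "(\<nu> - p) / (\<mu> - p) \<in> \<real>\<^sub>\<le>\<^sub>0"
  then obtain r where r: "(\<nu> - p) / (\<mu> - p) = complex_of_real r" "r \<le> 0"
    using nonpos_Reals_cases by metis
  have "\<mu> \<noteq> p"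
    using assms by (auto simp: is_star_center_def)
  then have "\<nu> - p = r * (\<mu> - p)"
    using r(1) by (simp add: field_simps)
  then have eq: "p * (1 - r) = \<nu> - r * \<mu>"
    by (simp add: algebra_simps)
  have r1: "1 - complex_of_real r \<noteq> 0"
    using r(2) by (metis diff_eq_eq of_real_1 of_real_eq_iff add_0 not_one_le_zero)
  have "p = (\<nu> - r * \<mu>) / (1 - r)"
    using eq r1 by (simp add: field_simps)
  also have "\<dots> = complex_of_real (1 / (1 - r)) * \<nu> + complex_of_real (1 - 1 / (1 - r)) * \<mu>"
  proof -
    have "1 - 1 / (1 - r) = - (r / (1 - r))"
      using r(2) by (simp add: field_simps)
    then show ?thesis
      by (simp add: diff_divide_distrib)
  qed
  also have "\<dots> \<in> S"
  proof -
    have "0 \<le> 1 / (1 - r)" "1 / (1 - r) \<le> 1"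
      using r(2) by auto
    then show ?thesis
      using assms(1,3) unfolding is_star_center_def by blast
  qed
  finally show False
    using assms(2) by simp
qed

section \<open>Star-shapedness for the convex hull of the family\<close>

theorem theorem3p5:
  fixes C :: "complex^'n^'n" and \<G> :: "(complex^'n^'n) set" and \<mu> :: complex
  assumes "\<G> \<noteq> {}"
    and "\<mu> \<in> (\<Inter>A\<in>\<G>. star_centers C A)"
  shows "is_star_center (C_numerical_range_family C (convex hull \<G>)) \<mu>"
proof -
  define f where "f U A = trace (C ** conj_transpose U ** A ** U)" for U A :: "complex^'n^'n"
  define W where "W = C_numerical_range_family C (convex hull \<G>)"
  have lin: "linear (f U)" for U
    unfolding f_def by (rule linear_trace_conjugate)
  have W: "f U A \<in> W" if "unitary U" "A \<in> convex hull \<G>" for U A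
    using that by (auto simp: W_def C_numerical_range_family_def C_numerical_range_def f_def)
  have star: "is_star_center (C_numerical_range C A) \<mu>" if "A \<in> \<G>" for A
    using assms(2) that by (auto simp: star_centers_def)
  have sub: "C_numerical_range C A \<subseteq> W" if "A \<in> \<G>" for A
    using that hull_inc[of A \<G>] by (auto simp: W_def C_numerical_range_family_def)
  have "\<mu> \<in> W"
    using assms(1) star sub unfolding is_star_center_def by blast
  moreover have "complex_of_real t * \<nu> + complex_of_real (1 - t) * \<mu> \<in> W"
    if "\<nu> \<in> W" "0 \<le> t" "t \<le> 1" for \<nu> t
  proof (rule ccontr)
    define p where "p = complex_of_real t * \<nu> + complex_of_real (1 - t) * \<mu>"
    assume "complex_of_real t * \<nu> + complex_of_real (1 - t) * \<mu> \<notin> W"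
    then have "p \<notin> W"
      by (simp add: p_def)
    then have "\<mu> \<noteq> p"
      using \<open>\<mu> \<in> W\<close> by auto
    obtain U A where U: "unitary U" and A: "A \<in> convex hull \<G>" and \<nu>: "\<nu> = f U A"
      using \<open>\<nu> \<in> W\<close>
      by (auto simp: W_def C_numerical_range_family_def C_numerical_range_def f_def)
    \<comment> \<open>This normalization sends \<open>p\<close> to 0 and \<mu> to 1, so that the
      excluded directions form the branch cut of \<open>Arg\<close>.\<close>
    define g where "g A V = (f V A - p) / (\<mu> - p)" for A V
    have g: "g A V \<notin> \<real>\<^sub>\<le>\<^sub>0" if "A \<in> \<G>" "unitary V" for A V
      unfolding g_def
    proof (rule star_center_imp_notin_nonpos_Reals[OF star])
      show "p \<notin> C_numerical_range C A"
        using sub \<open>p \<notin> W\<close> that by blast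
      show "f V A \<in> C_numerical_range C A"
        using that by (auto simp: C_numerical_range_def f_def)
    qed (use that in auto)
    have g_nz: "g A V \<noteq> 0" if "A \<in> \<G>" "unitary V" for A V
      using g[OF that] by auto
    have Arg_lt: "\<bar>Arg (g A V)\<bar> < pi" if "A \<in> \<G>" "unitary V" for A V
      using g[OF that] Arg_bounded[of "g A V"] Arg_eq_pi[of "g A V"]
      by (auto simp: complex_nonpos_Reals_iff abs_if)
    have cont: "continuous_on {V. unitary V} (\<lambda>V. Arg (g A V))" if "A \<in> \<G>" for A
    proof (rule continuous_on_Arg[THEN continuous_on_compose2])
      show "continuous_on {V. unitary V} (g A)"
        unfolding g_def f_def using \<open>\<mu> \<noteq> p\<close>
        by (intro continuous_intros continuous_on_trace_conjugate) auto
    qed (use g that in auto)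
    have ne_pi: "\<bar>Arg (g A V) - Arg (g B V)\<bar> \<noteq> pi"
      if AB: "A \<in> \<G>" "B \<in> \<G>" and V: "unitary V" for A B V
    proof
      assume "\<bar>Arg (g A V) - Arg (g B V)\<bar> = pi"
      then have "0 \<in> closed_segment (g A V) (g B V)"
        using g_nz AB V by (intro Arg_diff_eq_pi_imp_segment) auto
      then obtain u where u: "0 \<le> u" "u \<le> 1" and "0 = (1 - u) *\<^sub>R g A V + u *\<^sub>R g B V"
        by (auto simp: in_segment)
      moreover have "(1 - u) *\<^sub>R g A V + u *\<^sub>R g B V =
          ((1 - u) *\<^sub>R (f V A - p) + u *\<^sub>R (f V B - p)) / (\<mu> - p)"
        by (simp add: g_def scaleR_conv_of_real add_divide_distrib)
      ultimately have "0 = (1 - u) *\<^sub>R (f V A - p) + u *\<^sub>R (f V B - p)"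
        using \<open>\<mu> \<noteq> p\<close> by simp
      \<comment> \<open>The same \<open>V\<close> serves \<open>A\<close> and \<open>B\<close>, so
        linearity turns a point between the two values into the value at a convex combination of the
        matrices.\<close>
      then have "p = f V ((1 - u) *\<^sub>R A + u *\<^sub>R B)"
        unfolding linear_add[OF lin] linear_scale[OF lin] by (simp add: algebra_simps)
      moreover have "(1 - u) *\<^sub>R A + u *\<^sub>R B \<in> convex hull \<G>"
        using u AB by (intro convexD convex_convex_hull hull_inc) auto
      ultimately show False
        using W[OF V] \<open>p \<notin> W\<close> by auto
    qed
    have close: "\<bar>Arg (g A U) - Arg (g B U)\<bar> < pi" if AB: "A \<in> \<G>" "B \<in> \<G>" for A B
    proof (rule ccontr)
      assume ge: "\<not> \<bar>Arg (g A U) - Arg (g B U)\<bar> < pi"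
      define D where "D = (\<lambda>V. \<bar>Arg (g A V) - Arg (g B V)\<bar>) ` {V. unitary V}"
      \<comment> \<open>At this \<open>V\<close> the angle of \<open>A\<close> is 0, so the
        difference is the angle of \<open>B\<close> alone. Any value of at least \<pi> elsewhere
        would force the value \<pi> in between.\<close>
      obtain V where V: "unitary V" "f V A = \<mu>"
        using star[OF AB(1)]
        by (auto simp: is_star_center_def C_numerical_range_def f_def)
      then have "g A V = 1"
        using \<open>\<mu> \<noteq> p\<close> by (simp add: g_def)
      then have "\<bar>Arg (g A V) - Arg (g B V)\<bar> \<le> pi"
        using Arg_lt[OF AB(2) V(1)] by simp
      moreover have "connected D"
        unfolding D_def
        by (intro connected_continuous_image connected_unitary continuous_intros cont AB)
      moreover have "\<bar>Arg (g A V) - Arg (g B V)\<bar> \<in> D" "\<bar>Arg (g A U) - Arg (g B U)\<bar> \<in> D"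
        using U V(1) by (auto simp: D_def)
      moreover have "pi \<le> \<bar>Arg (g A U) - Arg (g B U)\<bar>"
        using ge by simp
      ultimately have "pi \<in> D"
        by (metis connectedD_interval)
      then obtain V' where V': "unitary V'" "pi = \<bar>Arg (g A V') - Arg (g B V')\<bar>"
        unfolding D_def by blast
      show False
        using ne_pi[OF AB V'(1)] V'(2)[symmetric] by (rule notE)
    qed
    obtain S w where S: "finite S" "S \<subseteq> \<G>" and w: "\<forall>B\<in>S. 0 \<le> w B" "sum w S = 1"
      and A_eq: "A = (\<Sum>B\<in>S. w B *\<^sub>R B)"
      using A by (auto simp: convex_hull_explicit)
    \<comment> \<open>The element 1 stands for \<mu>: the image 0 of \<open>p\<close> is a convex
      combination of 1 and the weighted mean of the \<open>g B U\<close>.\<close>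
    define X where "X = insert 1 ((\<lambda>B. g B U) ` S)"
    have "(\<Sum>B\<in>S. w B *\<^sub>R g B U) = (\<nu> - p) / (\<mu> - p)"
    proof -
      have "(\<Sum>B\<in>S. w B *\<^sub>R (f U B - p)) = \<nu> - p"
        using w(2) by (simp add: \<nu> A_eq linear_sum[OF lin] linear_scale[OF lin] sum_subtractf
            scaleR_diff_right flip: scaleR_sum_left)
      then show ?thesis
        by (simp add: g_def scaleR_conv_of_real flip: sum_divide_distrib)
    qed
    moreover have "(\<Sum>B\<in>S. w B *\<^sub>R g B U) \<in> convex hull X"
      using S(1) w by (intro convex_sum convex_convex_hull hull_inc) (auto simp: X_def)
    ultimately have "t *\<^sub>R ((\<nu> - p) / (\<mu> - p)) + (1 - t) *\<^sub>R 1 \<in> convex hull X"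
      using \<open>0 \<le> t\<close> \<open>t \<le> 1\<close>
      by (intro convexD convex_convex_hull) (auto simp: X_def intro: hull_inc)
    moreover have "t *\<^sub>R ((\<nu> - p) / (\<mu> - p)) + (1 - t) *\<^sub>R 1 = 0"
    proof -
      have "t * (\<nu> - p) + (1 - t) * (\<mu> - p) = 0"
        by (simp add: p_def algebra_simps)
      then show ?thesis
        using \<open>\<mu> \<noteq> p\<close> by (simp add: scaleR_conv_of_real field_simps)
    qed
    moreover have "0 \<notin> convex hull X"
    proof (rule zero_notin_convex_hull_if_Arg_close)
      show "finite X" "0 \<notin> X"
        using S U g_nz by (auto simp: X_def)
      \<comment> \<open>Pairs containing 1, whose argument is 0, are settled by
        \<open>Arg_lt\<close>, the others by \<open>close\<close>.\<close>
      show "\<bar>Arg x - Arg y\<bar> < pi" if "x \<in> X" "y \<in> X" for x y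
        using that S(2) close Arg_lt U by (auto simp: X_def subset_iff)
    qed
    ultimately show False
      by simp
  qed
  ultimately show ?thesis
    by (simp add: is_star_center_def W_def)
qed

end
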